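(* Let $p$ and $q$ be monic real-rooted polynomials of degree $n$, each with simple roots, having a common interlacer and having distinct roots (no root of $p$ is a root of $q$). Let $\lambda_1>\dots>\lambda_n$ be the roots of $p$ and $\mu_1>\dots>\mu_n$ the roots of $q$, and assume $\sum_{i=1}^n\lambda_i=\sum_{i=1}^n\mu_i$. For $t\in[0,1]$ let $\lambda_1(t)\ge\dots\ge\lambda_n(t)$ be the roots of $tp+(1-t)q$. Then $p$ strongly majorizes $q$ (written $p\succeq^s q$) if and only if for every integer $1\le k<n$ the function $$t\mapsto \sum_{i=1}^k\lambda_i(t)$$ is strictly increasing on $[0,1]$.
   Context: Roots are always listed in nonincreasing order (with multiplicity). Majorization: for real vectors $a_1\ge\dots\ge a_n$ and $b_1\ge\dots\ge b_n$, $a\succeq b$ means $\sum_{i=1}^k a_i\ge\sum_{i=1}^k b_i$ for all $k\le n$ and $\sum_{i=1}^n a_i=\sum_{i=1}^n b_i$. For real-rooted polynomials of the same degree, one majorizes the other ($\succeq$) if its ordered root vector majorizes that of the other. Common interlacer: $p$ and $q$ have a common interlacer if there is a third polynomial interlacing both; explicitly, the closed intervals with endpoints $\lambda_i,\mu_i$ ($1\le i\le n$) are non-crossing, i.e. $\max(\lambda_{i+1},\mu_{i+1})\le\min(\lambda_i,\mu_i)$ for $1\le i<n$. In that case $tp+(1-t)q$ is real-rooted for every $t\in[0,1]$. Strong majorization: for $p,q$ with a common interlacer, let $S_k(t)=\sum_{i=1}^k\lambda_i(t)$, $t\in[0,1]$. Then $p\succeq^s q$ means that $sp+(1-s)q\succeq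 tp+(1-t)q$ for all $0\le t\le s\le 1$; that is, each $S_k$ is nondecreasing on $[0,1]$ and $S_n$ is constant. *)

theory Defs
  imports "HOL-Computational_Algebra.Computational_Algebra"
begin

definition real_rooted :: "real poly \<Rightarrow> bool" where
  "real_rooted p \<longleftrightarrow> (\<forall>z::complex. poly (map_poly of_real p) z = 0 \<longrightarrow> z \<in> \<real>)"

(* Real roots with multiplicity, largest first. Indexing is 0-based: the i-th largest root,
   i \<ge> 1, is desc_roots p ! (i - 1). *)
definition desc_roots :: "real poly \<Rightarrow> real list" where
  "desc_roots p = rev (sorted_list_of_multiset (proots p))"

(* Majorization of vectors; intended only for nonincreasing lists. *)
definition majorizes :: "real list \<Rightarrow> real list \<Rightarrow> bool" where
  "majorizes a b \<longleftrightarrow> length a = length b \<and>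
     (\<forall>k\<le>length b. (\<Sum>i<k. a ! i) \<ge> (\<Sum>i<k. b ! i)) \<and>
     (\<Sum>i<length a. a ! i) = (\<Sum>i<length b. b ! i)"

definition poly_majorizes :: "real poly \<Rightarrow> real poly \<Rightarrow> bool" where
  "poly_majorizes p q \<longleftrightarrow> real_rooted p \<and> real_rooted q \<and> degree p = degree q \<and>
     majorizes (desc_roots p) (desc_roots q)"

(* In degree 0 truncated subtraction makes every nonzero constant interlace every other,
   in agreement with the (then empty) inequalities of common_interlacer_iff below. *)
definition interlaces :: "real poly \<Rightarrow> real poly \<Rightarrow> bool" where
  "interlaces g f \<longleftrightarrow> real_rooted g \<and> real_rooted f \<and> degree g = degree f - 1 \<and>
     (\<forall>i. Suc i < degree f \<longrightarrow>
        desc_roots f ! Suc i \<le> desc_roots g ! i \<and> desc_roots g ! i \<le> desc_roots f ! i)"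

definition common_interlacer :: "real poly \<Rightarrow> real poly \<Rightarrow> bool" where
  "common_interlacer p q \<longleftrightarrow> (\<exists>g. interlaces g p \<and> interlaces g q)"

definition strongly_majorizes :: "real poly \<Rightarrow> real poly \<Rightarrow> bool" where
  "strongly_majorizes p q \<longleftrightarrow> common_interlacer p q \<and>
     (\<forall>s t. 0 \<le> t \<and> t \<le> s \<and> s \<le> 1 \<longrightarrow>
        poly_majorizes (smult s p + smult (1 - s) q) (smult t p + smult (1 - t) q))"

lemma desc_roots_prod_linear:
  fixes rs :: "real list"
  assumes "sorted (rev rs)"
  shows "desc_roots (\<Prod>r\<leftarrow>rs. [:- r, 1:]) = rs"
proof -
  have "proots (\<Prod>r\<leftarrow>rs. [:- r, 1:]) = mset rs"
  proof (induction rs)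
    case (Cons a rs)
    have "(\<Prod>r\<leftarrow>rs. [:- r, 1:]) \<noteq> 0"
      by (auto simp: prod_list_zero_iff)
    with Cons show ?case by (simp add: proots_mult del: mult_pCons_left)
  qed simp
  then have "desc_roots (\<Prod>r\<leftarrow>rs. [:- r, 1:]) = rev (sorted_list_of_multiset (mset (rev rs)))"
    by (simp add: desc_roots_def)
  also have "\<dots> = rs"
    unfolding sorted_list_of_multiset_mset by (simp add: sorted_sort_id[OF assms])
  finally show ?thesis .
qed

lemma degree_prod_linear:
  fixes rs :: "real list"
  shows "degree (\<Prod>r\<leftarrow>rs. [:- r, 1:]) = length rs"
proof (induction rs)
  case (Cons a rs)
  have "(\<Prod>r\<leftarrow>rs. [:- r, 1:]) \<noteq> 0"
    by (auto simp: prod_list_zero_iff)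
  then have "degree ([:- a, 1:] * (\<Prod>r\<leftarrow>rs. [:- r, 1:])) = Suc (length rs)"
    using Cons by (subst degree_mult_eq) auto
  then show ?case by simp
qed simp

lemma real_rooted_prod_linear:
  fixes rs :: "real list"
  shows "real_rooted (\<Prod>r\<leftarrow>rs. [:- r, 1:])"
  unfolding real_rooted_def
proof (induction rs)
  case (Cons a rs)
  have "map_poly of_real ([:- a, 1:] * (\<Prod>r\<leftarrow>rs. [:- r, 1:])) =
      ([:- of_real a, 1:] :: complex poly) * map_poly of_real (\<Prod>r\<leftarrow>rs. [:- r, 1:])"
    by (rule poly_eqI) (simp add: coeff_map_poly coeff_pCons split: nat.split)
  with Cons show ?case by (auto simp del: mult_pCons_left)
qed simp

lemma common_interlacer_iff:
  assumes "real_rooted p" "real_rooted q" "degree p = n" "degree q = n"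
  shows "common_interlacer p q \<longleftrightarrow>
    (\<forall>i. Suc i < n \<longrightarrow> max (desc_roots p ! Suc i) (desc_roots q ! Suc i)
                    \<le> min (desc_roots p ! i) (desc_roots q ! i))"
    (is "_ \<longleftrightarrow> ?R")
proof
  assume "common_interlacer p q"
  then obtain g where "interlaces g p" "interlaces g q"
    by (auto simp: common_interlacer_def)
  then show ?R
    using assms by (fastforce simp: interlaces_def)
next
  assume R: ?R
  define c where "c i = max (desc_roots p ! Suc i) (desc_roots q ! Suc i)" for i
  define rs where "rs = map c [0..<n - 1]"
  define g where "g = (\<Prod>r\<leftarrow>rs. [:- r, 1:])"
  have "c (Suc i) \<le> c i" if "Suc i < n - 1" for i
    using R[rule_format, of "Suc i"] that by (simp add: c_def le_max_iff_disj)
  then have "sorted (rev rs)"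
    by (auto simp: sorted_rev_iff_nth_Suc rs_def)
  then have "desc_roots g = rs"
    unfolding g_def by (rule desc_roots_prod_linear)
  moreover have "real_rooted g" "degree g = n - 1"
    using real_rooted_prod_linear[of rs] degree_prod_linear[of rs]
    unfolding g_def by (simp_all only: rs_def length_map length_upt diff_zero)
  moreover have "desc_roots p ! Suc i \<le> rs ! i" "desc_roots q ! Suc i \<le> rs ! i"
      "rs ! i \<le> desc_roots p ! i" "rs ! i \<le> desc_roots q ! i" if "Suc i < n" for i
    using R that by (auto simp: rs_def c_def)
  ultimately show "common_interlacer p q"
    unfolding common_interlacer_def interlaces_def using assms by auto
qed

end

theory Submission
  imports Defs
begin

text \<open>
  Write \<open>f\<^sub>t = t p + (1 - t) q\<close> and let \<open>S\<^sub>k(t)\<close> be the sum of its \<open>k\<close> largest roots. Points that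
  separate the root intervals of \<open>p\<close> and \<open>q\<close> are sign changes of every \<open>f\<^sub>t\<close>, so each \<open>f\<^sub>t\<close> with
  \<open>t \<in> [0,1]\<close> has \<open>n\<close> simple real roots (\<open>simple_roots_convex_combination\<close>), and
  \<open>S\<^sub>n\<close> is constant because it is minus a coefficient that \<open>p\<close> and \<open>q\<close> share. So strong majorization
  says that \<open>S\<^sub>k\<close> is nondecreasing for \<open>1 \<le> k < n\<close>. What remains is that a nondecreasing \<open>S\<^sub>k\<close> cannot
  be constant on an interval; in fact \<open>S\<^sub>k\<close> takes each value only finitely often
  (\<open>finite_level_set_top_sum\<close>).

  The conceptual reason is Galois-theoretic. Since \<open>p\<close> and \<open>q\<close> are coprime, \<open>f\<^sub>t\<close> is irreducible over
  the field of rational functions in \<open>t\<close>, so its Galois group permutes the roots transitively. If the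
  roots with index in \<open>{1..k}\<close> had constant sum \<open>c\<close>, then so would the roots with index in
  \<open>g{1..k}\<close>, for every \<open>g\<close> in the group. Transitivity provides a \<open>g\<close> with
  \<open>g{1..k} \<noteq> {1..k}\<close>, and for real distinct roots the sum over any other \<open>k\<close>-subset is strictly
  smaller than the sum of the \<open>k\<close> largest ones.

  The argument below makes this elementary. For a root \<open>x = \<lambda>\<^sub>j(t)\<close> consider
  \<open>\<Theta>(t, x) = \<Prod>\<^sub>B (c - \<Sum>\<^sub>i\<^sub>\<in>\<^sub>B \<lambda>\<^sub>i(t))\<close>, the product over all \<open>k\<close>-subsets \<open>B\<close> containing \<open>j\<close>. It is symmetric
  in the roots other than \<open>x\<close>, hence a polynomial in \<open>t\<close> and \<open>x\<close>
  (\<open>eliminate_all_but_one_variable\<close>). Whenever \<open>S\<^sub>k(t) = c\<close>, it vanishes at the largest root. But the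
  curve \<open>f\<^sub>t(x) = 0\<close> is the graph \<open>t = q(x) / (q(x) - p(x))\<close>, so on it \<open>\<Theta>\<close> is a rational function of \<open>x\<close>
  alone. Infinitely many zeros force \<open>\<Theta>\<close> to vanish on the whole curve, in particular at the smallest
  root. So some \<open>k\<close>-subset containing the smallest root also has sum \<open>c\<close>, which is absurd.
\<close>

section \<open>Polynomial functions of a parameter and finitely many variables\<close>

text \<open>
  Multivariate polynomials enter only through the functions that they define: \<open>t\<close> is the parameter of
  the family, and only \<open>x 0, \<dots>, x (m - 1)\<close> may occur. The number \<open>m\<close> is an ordinary argument, so that
  variables can be eliminated one after the other by induction.
\<close>
inductive poly_fun :: "nat \<Rightarrow> (real \<Rightarrow> (nat \<Rightarrow> real) \<Rightarrow> real) \<Rightarrow> bool" for m where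
  const: "poly_fun m (\<lambda>t x. c)"
| param: "poly_fun m (\<lambda>t x. t)"
| var: "i < m \<Longrightarrow> poly_fun m (\<lambda>t x. x i)"
| add: "poly_fun m F \<Longrightarrow> poly_fun m G \<Longrightarrow> poly_fun m (\<lambda>t x. F t x + G t x)"
| mult: "poly_fun m F \<Longrightarrow> poly_fun m G \<Longrightarrow> poly_fun m (\<lambda>t x. F t x * G t x)"

lemma poly_fun_diff:
  assumes "poly_fun m F" "poly_fun m G"
  shows "poly_fun m (\<lambda>t x. F t x - G t x)"
  using poly_fun.add[OF assms(1) poly_fun.mult[OF poly_fun.const[of m "-1"] assms(2)]] by simp

lemma poly_fun_sum:
  assumes "\<And>a. a \<in> A \<Longrightarrow> poly_fun m (F a)"
  shows "poly_fun m (\<lambda>t x. \<Sum>a\<in>A. F a t x)"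
  using assms
  by (induction A rule: infinite_finite_induct) (auto intro: poly_fun.intros)

lemma poly_fun_prod:
  assumes "\<And>a. a \<in> A \<Longrightarrow> poly_fun m (F a)"
  shows "poly_fun m (\<lambda>t x. \<Prod>a\<in>A. F a t x)"
  using assms
  by (induction A rule: infinite_finite_induct) (auto intro: poly_fun.intros)

lemma poly_fun_poly: "poly_fun m (\<lambda>t x. poly c t)"
proof (induction c)
  case (pCons a c)
  then show ?case by (simp add: poly_fun.intros)
qed (simp add: poly_fun.const)

lemma poly_fun_cong:
  assumes "poly_fun m F" "\<And>i. i < m \<Longrightarrow> x i = y i"
  shows "F t x = F t y"
  using assms by induction auto

lemma poly_fun_identify_variables:
  assumes "poly_fun (Suc m) F" "b < m"
  shows "poly_fun m (\<lambda>t x. F t (x(m := x b)))"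
  using assms
proof induction
  case (var i)
  then show ?case by (cases "i = m") (auto intro: poly_fun.intros)
qed (auto intro: poly_fun.intros)

text \<open>
  A polynomial in \<open>m + 1\<close> variables expanded in powers of the last one. Summation over the roots is
  additive but not multiplicative, so it is this presentation, and not \<open>poly_fun\<close> itself, that
  supports an induction for \<open>sum_over_roots_top_expansion\<close>.
\<close>
inductive top_expansion :: "nat \<Rightarrow> (real \<Rightarrow> (nat \<Rightarrow> real) \<Rightarrow> real) \<Rightarrow> bool" for m where
  monomial: "poly_fun m a \<Longrightarrow> top_expansion m (\<lambda>t x. a t x * x m ^ d)"
| add: "top_expansion m F \<Longrightarrow> top_expansion m G \<Longrightarrow> top_expansion m (\<lambda>t x. F t x + G t x)"

lemma top_expansion_mult:
  assumes "top_expansion m F" "top_expansion m G"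
  shows "top_expansion m (\<lambda>t x. F t x * G t x)"
  using assms(1)
proof induction
  case (monomial a d)
  show ?case using assms(2)
  proof induction
    case (monomial b e)
    have "top_expansion m (\<lambda>t x. (a t x * b t x) * x m ^ (d + e))"
      by (intro top_expansion.monomial poly_fun.mult monomial \<open>poly_fun m a\<close>)
    then show ?case by (simp add: power_add mult_ac)
  qed (auto simp: distrib_left intro: top_expansion.add)
qed (auto simp: distrib_right intro: top_expansion.add)

lemma poly_fun_imp_top_expansion:
  assumes "poly_fun (Suc m) F"
  shows "top_expansion m F"
  using assms
proof induction
  case (const c)
  show ?case using top_expansion.monomial[OF poly_fun.const, of m c 0] by simp
next
  case param
  show ?case using top_expansion.monomial[OF poly_fun.param, of m 0] by simp
next
  case (var i)
  show ?case
  proof (cases "i = m")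
    case True
    then show ?thesis using top_expansion.monomial[OF poly_fun.const, of m 1 1] by simp
  next
    case False
    then show ?thesis using var top_expansion.monomial[OF poly_fun.var, of i m 0] by simp
  qed
qed (auto intro: top_expansion_mult top_expansion.add)

section \<open>Symmetric functions of the roots\<close>

text \<open>
  Summed over all roots, a power of the last variable becomes a power sum, which is a polynomial in \<open>t\<close>;
  its coefficient, free of that variable, factors out.
\<close>
lemma sum_over_roots_top_expansion:
  assumes pow: "\<And>d. \<exists>P. \<forall>t\<in>T. (\<Sum>i<n. r t i ^ d) = poly P t"
    and "top_expansion m F"
  shows "\<exists>G. poly_fun m G \<and> (\<forall>t\<in>T. \<forall>x. (\<Sum>i<n. F t (x(m := r t i))) = G t x)"
  using assms(2)
proof induction
  case (monomial a d)
  obtain P where P: "\<forall>t\<in>T. (\<Sum>i<n. r t i ^ d) = poly P t" using pow by blast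
  have *: "a t (x(m := y)) = a t x" for t x y
    by (rule poly_fun_cong[OF monomial]) auto
  have "poly_fun m (\<lambda>t x. a t x * poly P t)"
    by (intro poly_fun.mult poly_fun_poly monomial)
  moreover have "(\<Sum>i<n. a t (x(m := r t i)) * (x(m := r t i)) m ^ d) = a t x * poly P t"
    if "t \<in> T" for t x
    using P that by (simp add: * flip: sum_distrib_left)
  ultimately show ?case by blast
next
  case (add F G)
  then obtain F' G' where
    "poly_fun m F'" "\<forall>t\<in>T. \<forall>x. (\<Sum>i<n. F t (x(m := r t i))) = F' t x"
    "poly_fun m G'" "\<forall>t\<in>T. \<forall>x. (\<Sum>i<n. G t (x(m := r t i))) = G' t x"
    by blast
  then show ?case
    by (intro exI[of _ "\<lambda>t x. F' t x + G' t x"]) (auto simp: sum.distrib intro: poly_fun.add simp del: fun_upd_apply)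
qed

text \<open>
  The step from \<open>m + 1\<close> to \<open>m\<close> variables averages \<open>F\<close> over the \<open>n - m\<close> roots that \<open>\<sigma>\<close> has not used yet.
  The sum over the unused roots is the sum over all roots, which is polynomial by power sums, minus the
  terms in which the last variable repeats an earlier one. At every unused root \<open>F\<close> has the same value
  \<open>\<Theta> t (\<sigma> 0)\<close>, so this is also the value of the average.
\<close>
lemma eliminate_top_variable:
  assumes pow: "\<And>d. \<exists>P. \<forall>t\<in>T. (\<Sum>i<n. r t i ^ d) = poly P t"
    and m: "0 < m" "m < n"
    and F: "poly_fun (Suc m) F"
    and val: "\<And>t \<sigma>. t \<in> T \<Longrightarrow> inj_on \<sigma> {..<Suc m} \<Longrightarrow> \<sigma> ` {..<Suc m} \<subseteq> {..<n} \<Longrightarrow>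
                F t (\<lambda>i. r t (\<sigma> i)) = \<Theta> t (\<sigma> 0)"
  shows "\<exists>G. poly_fun m G \<and>
    (\<forall>t \<sigma>. t \<in> T \<longrightarrow> inj_on \<sigma> {..<m} \<longrightarrow> \<sigma> ` {..<m} \<subseteq> {..<n} \<longrightarrow>
       G t (\<lambda>i. r t (\<sigma> i)) = \<Theta> t (\<sigma> 0))"
proof -
  obtain H where H: "poly_fun m H"
    "\<And>t x. t \<in> T \<Longrightarrow> (\<Sum>i<n. F t (x(m := r t i))) = H t x"
    using sum_over_roots_top_expansion[OF pow poly_fun_imp_top_expansion[OF F]] by metis
  define G where "G = (\<lambda>t x. (1 / real (n - m)) * (H t x - (\<Sum>b<m. F t (x(m := x b)))))"
  have "poly_fun m G"
    unfolding G_def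
    by (intro poly_fun.mult poly_fun.const poly_fun_diff H poly_fun_sum
        poly_fun_identify_variables F) auto
  moreover have "G t (\<lambda>i. r t (\<sigma> i)) = \<Theta> t (\<sigma> 0)"
    if t: "t \<in> T" and inj: "inj_on \<sigma> {..<m}" and sub: "\<sigma> ` {..<m} \<subseteq> {..<n}" for t \<sigma>
  proof -
    let ?x = "\<lambda>i. r t (\<sigma> i)" and ?U = "\<sigma> ` {..<m}"
    have upd: "?x(m := r t i) = (\<lambda>j. r t ((\<sigma>(m := i)) j))" for i by auto
    have new: "F t (?x(m := r t i)) = \<Theta> t (\<sigma> 0)" if "i \<in> {..<n} - ?U" for i
    proof -
      have "F t (\<lambda>j. r t ((\<sigma>(m := i)) j)) = \<Theta> t ((\<sigma>(m := i)) 0)"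
        using that inj sub by (intro val t) (auto simp: inj_on_def lessThan_Suc)
      with m(1) show ?thesis by (simp add: upd)
    qed
    have "H t ?x = (\<Sum>i<n. F t (?x(m := r t i)))" using H(2)[OF t] by simp
    also have "\<dots> = (\<Sum>i\<in>{..<n} - ?U. F t (?x(m := r t i))) + (\<Sum>i\<in>?U. F t (?x(m := r t i)))"
      using sub by (intro sum.subset_diff) auto
    also have "(\<Sum>i\<in>{..<n} - ?U. F t (?x(m := r t i))) = real (n - m) * \<Theta> t (\<sigma> 0)"
      using new sub inj by (simp add: card_Diff_subset card_image)
    also have "(\<Sum>i\<in>?U. F t (?x(m := r t i))) = (\<Sum>b<m. F t (?x(m := ?x b)))"
      using inj by (simp add: sum.reindex)
    finally show ?thesis using m(2) by (simp add: G_def)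
  qed
  ultimately show ?thesis by blast
qed

text \<open>
  A form of the theorem on symmetric functions: the hypothesis on \<open>F\<close> says that its value at an ordering
  of all the roots depends only on which root comes first, that is, \<open>F\<close> is symmetric in the others there.
  Division by positive integers, which the averaging needs, replaces the usual induction with
  elementary symmetric polynomials.
\<close>
lemma eliminate_all_but_one_variable:
  assumes pow: "\<And>d. \<exists>P. \<forall>t\<in>T. (\<Sum>i<n. r t i ^ d) = poly P t"
    and n: "0 < n" and F: "poly_fun n F"
    and val: "\<And>t \<sigma>. t \<in> T \<Longrightarrow> inj_on \<sigma> {..<n} \<Longrightarrow> \<sigma> ` {..<n} \<subseteq> {..<n} \<Longrightarrow>
                F t (\<lambda>i. r t (\<sigma> i)) = \<Theta> t (\<sigma> 0)"
  shows "\<exists>G. poly_fun 1 G \<and> (\<forall>t\<in>T. \<forall>j<n. G t (\<lambda>_. r t j) = \<Theta> t j)"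
proof -
  define P where "P m \<longleftrightarrow> (\<exists>G. poly_fun m G \<and>
    (\<forall>t \<sigma>. t \<in> T \<longrightarrow> inj_on \<sigma> {..<m} \<longrightarrow> \<sigma> ` {..<m} \<subseteq> {..<n} \<longrightarrow>
       G t (\<lambda>i. r t (\<sigma> i)) = \<Theta> t (\<sigma> 0)))" for m
  have "1 \<le> n" using n by simp
  then have "P 1"
  proof (induction rule: inc_induct)
    case base
    show ?case unfolding P_def using F val by blast
  next
    case (step m)
    then obtain F where F: "poly_fun (Suc m) F"
      "\<And>t \<sigma>. t \<in> T \<Longrightarrow> inj_on \<sigma> {..<Suc m} \<Longrightarrow> \<sigma> ` {..<Suc m} \<subseteq> {..<n} \<Longrightarrow>
                F t (\<lambda>i. r t (\<sigma> i)) = \<Theta> t (\<sigma> 0)"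
      unfolding P_def by blast
    show ?case
      unfolding P_def by (rule eliminate_top_variable[OF pow _ _ F]) (use step in auto)
  qed
  then obtain G where G: "poly_fun 1 G"
    "\<And>t \<sigma>. t \<in> T \<Longrightarrow> inj_on \<sigma> {..<1} \<Longrightarrow> \<sigma> ` {..<1} \<subseteq> {..<n} \<Longrightarrow>
       G t (\<lambda>i. r t (\<sigma> i)) = \<Theta> t (\<sigma> 0)"
    unfolding P_def by blast
  have "G t (\<lambda>_. r t j) = \<Theta> t j" if "t \<in> T" "j < n" for t j
    using G(2)[of t "\<lambda>_. j"] that by (auto simp: inj_on_def)
  then show ?thesis using G(1) by blast
qed

text \<open>
  Newton's identities in recursive form. Let \<open>g\<^sub>i = f / (x - r\<^sub>i)\<close> and let \<open>s j d\<close> be the sum over \<open>i\<close> of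
  \<open>r\<^sub>i\<^sup>d\<close> times the coefficient of \<open>x\<^sup>j\<close> in \<open>g\<^sub>i\<close>. Comparing coefficients in \<open>f = (x - r\<^sub>i) g\<^sub>i\<close>
  expresses \<open>s (j + 1) (d + 1)\<close> through \<open>s j d\<close>, a coefficient of \<open>f\<close> and the \<open>d\<close>-th power sum, which is
  itself \<open>s (n - 1) d\<close> since \<open>g\<^sub>i\<close> is monic. The induction starts from \<open>\<Sum>\<^sub>i g\<^sub>i = f'\<close>. Treating all \<open>j\<close>
  at once avoids a distinction between \<open>d < n\<close> and \<open>d \<ge> n\<close>.
\<close>
lemma power_sums_polynomial:
  fixes f :: "real \<Rightarrow> real poly" and n :: nat
  assumes f: "\<And>t. t \<in> T \<Longrightarrow> f t = (\<Prod>i<n. [:- r t i, 1:])"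
    and coeffs: "\<And>j. \<exists>P. \<forall>t\<in>T. coeff (f t) j = poly P t"
  shows "\<exists>P. \<forall>t\<in>T. (\<Sum>i<n. r t i ^ d) = poly P t"
proof (cases "n = 0")
  case True
  then show ?thesis by (auto intro: exI[of _ 0])
next
  case False
  define g where "g t i = (\<Prod>j\<in>{..<n} - {i}. [:- r t j, 1:])" for t i
  define s where "s j d t = (\<Sum>i<n. r t i ^ d * coeff (g t i) j)" for j d t
  have f_g: "f t = [:- r t i, 1:] * g t i" if "t \<in> T" "i < n" for t i
    unfolding f[OF that(1)] g_def using that(2) by (subst prod.remove[of _ i]) auto
  have deg_g: "degree (g t i) = n - 1" "lead_coeff (g t i) = 1" if "i < n" for t i
    unfolding g_def lead_coeff_prod using that by (auto simp: degree_prod_eq_sum_degree)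
  have top: "s (n - 1) d t = (\<Sum>i<n. r t i ^ d)" for d t
    unfolding s_def using deg_g by (intro sum.cong) auto
  have "\<exists>P. \<forall>t\<in>T. s j d t = poly P t" for j
  proof (induction d arbitrary: j)
    case 0
    obtain P where P: "\<forall>t\<in>T. coeff (f t) (Suc j) = poly P t" using coeffs by blast
    have "s j 0 t = poly (smult (real (Suc j)) P) t" if "t \<in> T" for t
    proof -
      have "pderiv (f t) = (\<Sum>i<n. g t i)"
        unfolding f[OF that] g_def by (simp add: pderiv_prod pderiv_pCons)
      then have "s j 0 t = coeff (pderiv (f t)) j"
        by (simp add: s_def coeff_sum)
      then show ?thesis using P that by (simp add: coeff_pderiv)
    qed
    then show ?case by blast
  next
    case (Suc d)
    obtain D where D: "\<forall>t\<in>T. (\<Sum>i<n. r t i ^ d) = poly D t"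
      using Suc[of "n - 1"] unfolding top by blast
    obtain P where P: "\<forall>t\<in>T. coeff (f t) j = poly P t" using coeffs by blast
    show ?case
    proof (cases j)
      case 0
      have "s j (Suc d) t = poly (- P * D) t" if "t \<in> T" for t
      proof -
        have "r t i ^ Suc d * coeff (g t i) j = - coeff (f t) 0 * r t i ^ d" if "i < n" for i
          using f_g[OF \<open>t \<in> T\<close> that] 0 by simp
        then have "s j (Suc d) t = - coeff (f t) 0 * (\<Sum>i<n. r t i ^ d)"
          by (simp add: s_def sum_distrib_left)
        then show ?thesis using P D that 0 by simp
      qed
      then show ?thesis by blast
    next
      case (Suc l)
      obtain Q where Q: "\<forall>t\<in>T. s l d t = poly Q t" using Suc.IH by blast
      have "s j (Suc d) t = poly (Q - P * D) t" if "t \<in> T" for t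
      proof -
        have "r t i ^ Suc d * coeff (g t i) j =
            r t i ^ d * coeff (g t i) l - coeff (f t) j * r t i ^ d" if "i < n" for i
        proof -
          have *: "coeff (f t) j = coeff (g t i) l - r t i * coeff (g t i) j"
            using f_g[OF \<open>t \<in> T\<close> that] Suc by simp
          show ?thesis unfolding * by (simp add: algebra_simps)
        qed
        then have "s j (Suc d) t = s l d t - coeff (f t) j * (\<Sum>i<n. r t i ^ d)"
          by (simp add: s_def sum_distrib_left sum_subtractf)
        then show ?thesis using P D Q that by simp
      qed
      then show ?thesis by blast
    qed
  qed
  then show ?thesis using top by metis
qed

section \<open>The sum of the largest roots takes each value finitely often\<close>

text \<open>
  On the curve \<open>t = u(x) / w(x)\<close> a polynomial in \<open>t\<close> and \<open>x\<close> is a rational function of \<open>x\<close> with a power of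
  \<open>w\<close> as denominator. This turns a statement about pairs \<open>(t, x)\<close> into one about roots of a
  univariate polynomial.
\<close>
lemma poly_fun_on_curve:
  fixes u w :: "real poly"
  assumes "poly_fun 1 F"
  shows "\<exists>N e. \<forall>t x. poly w (x 0) * t = poly u (x 0) \<longrightarrow>
           poly w (x 0) ^ N * F t x = poly e (x 0)"
  using assms
proof induction
  case (const c)
  show ?case by (rule exI[of _ 0], rule exI[of _ "[:c:]"]) simp
next
  case param
  show ?case by (rule exI[of _ 1], rule exI[of _ u]) simp
next
  case (var i)
  then show ?case by (intro exI[of _ 0] exI[of _ "[:0, 1:]"]) simp
next
  case (add F G)
  then obtain N M d e where *:
    "\<And>t x. poly w (x 0) * t = poly u (x 0) \<Longrightarrow> poly w (x 0) ^ N * F t x = poly d (x 0)"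
    "\<And>t x. poly w (x 0) * t = poly u (x 0) \<Longrightarrow> poly w (x 0) ^ M * G t x = poly e (x 0)"
    by blast
  show ?case
    by (rule exI[of _ "N + M"], rule exI[of _ "w ^ M * d + w ^ N * e"])
       (auto simp: power_add distrib_left mult_ac simp flip: *)
next
  case (mult F G)
  then obtain N M d e where *:
    "\<And>t x. poly w (x 0) * t = poly u (x 0) \<Longrightarrow> poly w (x 0) ^ N * F t x = poly d (x 0)"
    "\<And>t x. poly w (x 0) * t = poly u (x 0) \<Longrightarrow> poly w (x 0) ^ M * G t x = poly e (x 0)"
    by blast
  show ?case
    by (rule exI[of _ "N + M"], rule exI[of _ "d * e"])
       (auto simp: power_add mult_ac simp flip: *)
qed

text \<open>
  After cancelling the common indices, \<open>a k\<close> separates the terms: those left in \<open>B\<close> are at most \<open>a k\<close>, those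
  left in \<open>{..<k}\<close> exceed it, and there are equally many of both, at least one because of \<open>n - 1\<close>.
\<close>
lemma sum_less_top_sum:
  fixes a :: "nat \<Rightarrow> real"
  assumes dec: "\<And>i j. i < j \<Longrightarrow> j < n \<Longrightarrow> a j < a i"
    and B: "B \<subseteq> {..<n}" "card B = k" "n - 1 \<in> B" "k < n"
  shows "sum a B < sum a {..<k}"
proof -
  have fin: "finite B" using B(1) finite_subset by blast
  let ?A = "{..<k}"
  have "card (?A - B) = card (B - ?A)"
    using B(2) fin
    by (metis card_lessThan card_le_sym_Diff finite_lessThan le_antisym order_refl)
  moreover have "n - 1 \<in> B - ?A" using B by auto
  ultimately have pos: "card (?A - B) > 0" and eq: "card (?A - B) = card (B - ?A)"
    using fin by (auto simp: card_gt_0_iff)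
  have "sum a (B - ?A) \<le> real (card (B - ?A)) * a k"
  proof (rule sum_bounded_above)
    fix i assume "i \<in> B - ?A"
    then show "a i \<le> a k" using dec[of k i] B(1) by (cases "i = k") auto
  qed
  also have "\<dots> = (\<Sum>i\<in>?A - B. a k)" by (simp add: eq)
  also have "\<dots> < sum a (?A - B)"
    using pos dec B(4) by (intro sum_strict_mono) (auto simp: card_gt_0_iff)
  finally have "sum a (B - ?A) < sum a (?A - B)" .
  moreover have "sum a B = sum a (B - ?A) + sum a (B \<inter> ?A)"
    using fin by (metis Diff_disjoint Int_Diff_Un Un_commute add.commute sum.Int_Diff)
  moreover have "sum a ?A = sum a (?A - B) + sum a (B \<inter> ?A)"
    by (metis Int_commute add.commute finite_lessThan sum.Int_Diff)
  ultimately show ?thesis by simp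
qed

text \<open>
  The substitute for transitivity of the Galois group: the function \<open>\<Theta>\<close> detects whether a root belongs
  to a \<open>k\<close>-subset of sum \<open>c\<close>, and being polynomial on an irreducible curve it cannot vanish
  infinitely often on the branch of the largest root without vanishing on every branch.
\<close>
lemma finite_level_set_top_sum:
  fixes p q :: "real poly" and r :: "real \<Rightarrow> nat \<Rightarrow> real"
  assumes f: "\<And>t. t \<in> T \<Longrightarrow> smult t p + smult (1 - t) q = (\<Prod>i<n. [:- r t i, 1:])"
    and dec: "\<And>t i j. t \<in> T \<Longrightarrow> i < j \<Longrightarrow> j < n \<Longrightarrow> r t j < r t i"
    and coprime: "\<And>x. poly p x = 0 \<Longrightarrow> poly q x \<noteq> 0"
    and k: "0 < k" "k < n"
  shows "finite {t \<in> T. (\<Sum>i<k. r t i) = c}"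
proof (rule ccontr)
  define L where "L = {t \<in> T. (\<Sum>i<k. r t i) = c}"
  assume "infinite {t \<in> T. (\<Sum>i<k. r t i) = c}"
  then have inf: "infinite L" by (simp add: L_def)
  then obtain t0 where t0: "t0 \<in> L" by fastforce
  \<comment> \<open>The parameter is a function of the root, with nonvanishing denominator: a common zero of
      \<open>f\<^sub>t\<close> and \<open>p - q\<close> would be a common root of \<open>p\<close> and \<open>q\<close>.\<close>
  have curve: "poly (p - q) x * t = poly (- q) x" and nz: "poly (p - q) x \<noteq> 0"
    if "t \<in> T" "i < n" "x = r t i" for t i x
  proof -
    have "poly (smult t p + smult (1 - t) q) x = 0"
      unfolding f[OF that(1)] poly_prod using that by auto
    then have root: "t * poly p x + (1 - t) * poly q x = 0" by simp
    then show "poly (p - q) x * t = poly (- q) x" by (simp add: algebra_simps)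
    show "poly (p - q) x \<noteq> 0" using root coprime[of x] by (auto simp: algebra_simps)
  qed
  have pow: "\<exists>P. \<forall>t\<in>T. (\<Sum>i<n. r t i ^ d) = poly P t" for d
  proof (rule power_sums_polynomial[OF f])
    fix j
    show "\<exists>P. \<forall>t\<in>T. coeff (smult t p + smult (1 - t) q) j = poly P t"
      by (rule exI[of _ "[:coeff q j, coeff p j - coeff q j:]"]) (simp add: algebra_simps)
  qed
  define \<B> where "\<B> j = {B. B \<subseteq> {..<n} \<and> card B = k \<and> j \<in> B}" for j
  define \<Theta> where "\<Theta> t j = (\<Prod>B\<in>\<B> j. c - (\<Sum>i\<in>B. r t i))" for t j
  \<comment> \<open>The variable \<open>x 0\<close> stands for the distinguished root; permuting the other variables permutes
      the factors.\<close>
  define F where "F = (\<lambda>(t::real) (x::nat \<Rightarrow> real). \<Prod>B\<in>\<B> 0. c - (\<Sum>i\<in>B. x i))"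
  have fin\<B>: "finite (\<B> j)" for j
    by (rule finite_subset[of _ "Pow {..<n}"]) (auto simp: \<B>_def)
  have "poly_fun n F"
    unfolding F_def
    by (intro poly_fun_prod poly_fun_diff poly_fun_sum poly_fun.const poly_fun.var)
       (auto simp: \<B>_def)
  moreover have "F t (\<lambda>i. r t (\<sigma> i)) = \<Theta> t (\<sigma> 0)"
    if inj: "inj_on \<sigma> {..<n}" and sub: "\<sigma> ` {..<n} \<subseteq> {..<n}" for t \<sigma>
  proof -
    have img: "\<sigma> ` {..<n} = {..<n}"
      by (rule endo_inj_surj[OF _ sub inj]) simp
    have "bij_betw ((`) \<sigma>) (\<B> 0) (\<B> (\<sigma> 0))"
      unfolding bij_betw_def
    proof
      show "inj_on ((`) \<sigma>) (\<B> 0)"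
        using inj by (auto simp: inj_on_def \<B>_def inj_on_image_eq_iff[OF inj])
      show "(`) \<sigma> ` \<B> 0 = \<B> (\<sigma> 0)"
      proof
        show "(`) \<sigma> ` \<B> 0 \<subseteq> \<B> (\<sigma> 0)"
          using img by (auto simp: \<B>_def intro!: card_image inj_on_subset[OF inj])
        show "\<B> (\<sigma> 0) \<subseteq> (`) \<sigma> ` \<B> 0"
        proof
          fix B assume B: "B \<in> \<B> (\<sigma> 0)"
          then obtain C where C: "C \<subseteq> {..<n}" "B = \<sigma> ` C"
            using img by (metis (no_types, lifting) \<B>_def mem_Collect_eq subset_imageE)
          have "card C = k"
            using B C card_image[OF inj_on_subset[OF inj C(1)]] by (simp add: \<B>_def)
          moreover have "0 \<in> C"
            using B C k inj by (auto simp: \<B>_def inj_on_image_mem_iff)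
          ultimately show "B \<in> (`) \<sigma> ` \<B> 0" using C by (auto simp: \<B>_def)
        qed
      qed
    qed
    then have "\<Theta> t (\<sigma> 0) = (\<Prod>B\<in>\<B> 0. c - (\<Sum>i\<in>\<sigma> ` B. r t i))"
      unfolding \<Theta>_def by (rule prod.reindex_bij_betw[symmetric])
    also have "\<dots> = (\<Prod>B\<in>\<B> 0. c - (\<Sum>i\<in>B. r t (\<sigma> i)))"
      by (intro prod.cong refl, subst sum.reindex)
         (auto simp: \<B>_def intro: inj_on_subset[OF inj])
    finally show ?thesis by (simp add: F_def)
  qed
  ultimately obtain E where E: "poly_fun 1 E" "\<And>t j. t \<in> T \<Longrightarrow> j < n \<Longrightarrow> E t (\<lambda>_. r t j) = \<Theta> t j"
    using eliminate_all_but_one_variable[OF pow, of F \<Theta>] k by auto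
  obtain N e where e: "\<And>t x. poly (p - q) x * t = poly (- q) x \<Longrightarrow>
      poly (p - q) x ^ N * E t (\<lambda>_. x) = poly e x"
    using poly_fun_on_curve[OF E(1), of "p - q" "- q"] by metis
  \<comment> \<open>A root determines its parameter, so infinitely many parameters give infinitely many zeros
      of \<open>e\<close>.\<close>
  have "inj_on (\<lambda>t. r t 0) L"
  proof (rule inj_onI)
    fix t t' assume *: "t \<in> L" "t' \<in> L" "r t 0 = r t' 0"
    then have "poly (p - q) (r t 0) * t = poly (p - q) (r t 0) * t'" "poly (p - q) (r t 0) \<noteq> 0"
      using curve[of t 0 "r t 0"] curve[of t' 0 "r t 0"] nz[of t 0 "r t 0"] k
      by (auto simp: L_def)
    then show "t = t'" by simp
  qed
  then have "infinite ((\<lambda>t. r t 0) ` L)" using inf by (simp add: finite_image_iff)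
  moreover have "poly e (r t 0) = 0" if "t \<in> L" for t
  proof -
    have t: "t \<in> T" "(\<Sum>i<k. r t i) = c" using that by (auto simp: L_def)
    have "{..<k} \<in> \<B> 0" using k by (auto simp: \<B>_def)
    then have "\<Theta> t 0 = 0"
      using fin\<B> t by (auto simp: \<Theta>_def intro!: prod_zero bexI[of _ "{..<k}"])
    then show ?thesis
      using e[OF curve[of t 0 "r t 0"]] E(2)[of t 0] t k by simp
  qed
  then have "(\<lambda>t. r t 0) ` L \<subseteq> {x. poly e x = 0}" by auto
  ultimately have "e = 0"
    using poly_roots_finite[of e] finite_subset by blast
  have t0': "t0 \<in> T" "(\<Sum>i<k. r t0 i) = c" using t0 by (auto simp: L_def)
  have "\<Theta> t0 (n - 1) = 0"
    using e[OF curve[of t0 "n - 1" "r t0 (n - 1)"]] nz[of t0 "n - 1" "r t0 (n - 1)"]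
      E(2)[of t0 "n - 1"] t0' k \<open>e = 0\<close> by auto
  then obtain B where "B \<in> \<B> (n - 1)" "(\<Sum>i\<in>B. r t0 i) = c"
    using fin\<B> by (auto simp: \<Theta>_def)
  then show False
    using sum_less_top_sum[of n "r t0" B k] dec[OF t0'(1)] t0' k by (auto simp: \<B>_def)
qed

section \<open>Convex combinations of polynomials with a common interlacer\<close>

lemma size_proots_real_rooted:
  assumes "real_rooted p" "p \<noteq> 0"
  shows "size (proots p) = degree p"
  using assms
proof (induction "degree p" arbitrary: p rule: less_induct)
  case less
  show ?case
  proof (cases "degree p = 0")
    case True
    then show ?thesis using size_proots_le[of p] by simp
  next
    case False
    have "\<not> constant (poly (map_poly of_real p :: complex poly))"
      using False by (simp add: constant_degree degree_map_poly)
    then obtain z :: complex where z: "poly (map_poly of_real p) z = 0"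
      using fundamental_theorem_of_algebra by blast
    then obtain a where a: "z = of_real a"
      using less.prems(1) by (auto simp: real_rooted_def elim: Reals_cases)
    have "poly (map_poly of_real p) (of_real a :: complex) = of_real (poly p a)"
      by (induction p) (simp_all add: map_poly_pCons)
    then have "poly p a = 0" using z a by simp
    then obtain h where h: "p = [:- a, 1:] * h" by (auto simp: poly_eq_0_iff_dvd)
    then have "h \<noteq> 0" using less.prems by auto
    then have deg: "degree p = Suc (degree h)" unfolding h by (subst degree_mult_eq) auto
    have "map_poly of_real p = (map_poly of_real [:- a, 1:] * map_poly of_real h :: complex poly)"
      unfolding h by (rule poly_eqI) (simp add: coeff_map_poly coeff_mult del: mult_pCons_left)
    then have "real_rooted h"
      using less.prems(1) unfolding real_rooted_def by (metis mult_zero_right poly_mult)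
    then show ?thesis
      using less.hyps[of h] deg \<open>h \<noteq> 0\<close> by (simp add: h proots_mult del: mult_pCons_left)
  qed
qed

lemma monic_eq_prod_linear:
  fixes f :: "real poly"
  assumes "degree f = n" "lead_coeff f = 1" "inj_on r {..<n}" "\<And>i. i < n \<Longrightarrow> poly f (r i) = 0"
  shows "f = (\<Prod>i<n. [:- r i, 1:])"
proof (rule poly_eqI_degree_lead_coeff[where A = "r ` {..<n}" and n = n])
  have "degree (\<Prod>i<n. [:- r i, 1:]) = n" by (simp add: degree_prod_eq_sum_degree)
  moreover have "lead_coeff (\<Prod>i<n. [:- r i, 1:]) = 1" unfolding lead_coeff_prod by simp
  ultimately show "coeff f n = coeff (\<Prod>i<n. [:- r i, 1:]) n" "degree (\<Prod>i<n. [:- r i, 1:]) \<le> n"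
    using assms by simp_all
  show "poly f z = poly (\<Prod>i<n. [:- r i, 1:]) z" if "z \<in> r ` {..<n}" for z
    using that assms(4) by (auto simp: poly_prod)
qed (use assms in \<open>auto simp: card_image\<close>)

text \<open>
  The product formula is part of the definition because both the sign pattern of \<open>f\<close> and the power sums
  of its roots are read off from it; it also makes \<open>f\<close> monic.
\<close>
definition simple_roots :: "nat \<Rightarrow> real poly \<Rightarrow> bool" where
  "simple_roots n f \<longleftrightarrow> real_rooted f \<and> degree f = n \<and> length (desc_roots f) = n \<and>
     (\<forall>i j. i < j \<longrightarrow> j < n \<longrightarrow> desc_roots f ! j < desc_roots f ! i) \<and>
     f = (\<Prod>i<n. [:- (desc_roots f ! i), 1:])"

lemma simple_rootsD:
  assumes "simple_roots n f"
  shows "real_rooted f" "degree f = n" "length (desc_roots f) = n"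
    and "i < j \<Longrightarrow> j < n \<Longrightarrow> desc_roots f ! j < desc_roots f ! i"
    and "f = (\<Prod>i<n. [:- (desc_roots f ! i), 1:])"
  using assms unfolding simple_roots_def by blast+

lemma simple_rootsI_decreasing:
  assumes f: "degree f = n" "lead_coeff f = 1"
    and roots: "\<And>i. i < n \<Longrightarrow> poly f (r i) = 0"
    and dec: "\<And>i j. i < j \<Longrightarrow> j < n \<Longrightarrow> r j < r i"
  shows "simple_roots n f"
proof -
  have "inj_on r {..<n}"
    by (rule linorder_inj_onI) (use dec in fastforce)+
  then have prod: "f = (\<Prod>i<n. [:- r i, 1:])"
    using f roots by (intro monic_eq_prod_linear)
  also have "\<dots> = (\<Prod>x\<leftarrow>map r [0..<n]. [:- x, 1:])"
    by (simp add: prod.list_conv_set_nth atLeast0LessThan)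
  finally have eq: "f = (\<Prod>x\<leftarrow>map r [0..<n]. [:- x, 1:])" .
  have "sorted (rev (map r [0..<n]))"
    by (auto simp: sorted_rev_iff_nth_Suc intro: less_imp_le dec)
  then have "desc_roots f = map r [0..<n]"
    using eq desc_roots_prod_linear by metis
  moreover have "real_rooted f"
    using eq real_rooted_prod_linear by metis
  ultimately show ?thesis
    using f dec prod by (simp add: simple_roots_def)
qed

lemma simple_rootsI_rsquarefree:
  assumes "degree f = n" "lead_coeff f = 1" "real_rooted f" "rsquarefree f"
  shows "simple_roots n f"
proof -
  have nz: "f \<noteq> 0" using assms(4) by (simp add: rsquarefree_def)
  have len: "length (desc_roots f) = n"
    using size_proots_real_rooted[OF assms(3) nz] assms(1)
    by (metis desc_roots_def length_rev mset_sorted_list_of_multiset size_mset)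
  have mset: "mset (desc_roots f) = proots f" by (simp add: desc_roots_def)
  have "count (mset (desc_roots f)) x \<le> 1" for x
    using assms(4) nz unfolding mset by (auto simp: rsquarefree_def dest: spec[of _ x])
  then have dist: "distinct (desc_roots f)"
    by (metis count_mset_0_iff distinct_count_atmost_1 le_less_Suc_eq less_Suc_eq_le
        less_one nat_less_le One_nat_def)
  have sorted: "sorted (rev (desc_roots f))" by (simp add: desc_roots_def)
  show ?thesis
  proof (rule simple_rootsI_decreasing[OF assms(1,2)])
    fix i assume "i < n"
    then have "desc_roots f ! i \<in> set_mset (proots f)"
      using len nth_mem[of i "desc_roots f"] by (simp flip: mset)
    then show "poly f (desc_roots f ! i) = 0" using nz by simp
  next
    fix i j assume "i < j" "j < n"
    then show "desc_roots f ! j < desc_roots f ! i"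
      using sorted dist len
      by (metis order_less_imp_le less_imp_neq less_trans nth_eq_iff_index_eq
          order_le_imp_less_or_eq sorted_rev_nth_mono)
  qed
qed

lemma sign_between_roots:
  fixes r :: "nat \<Rightarrow> real"
  assumes "i \<le> n" "\<And>j. j < i \<Longrightarrow> x < r j" "\<And>j. i \<le> j \<Longrightarrow> j < n \<Longrightarrow> r j < x"
  shows "0 < (- 1) ^ i * poly (\<Prod>j<n. [:- r j, 1:]) x"
proof -
  have "{..<n} = {..<i} \<union> {i..<n}" using assms(1) by auto
  then have "(\<Prod>j<n. x - r j) = (\<Prod>j<i. x - r j) * (\<Prod>j=i..<n. x - r j)"
    by (simp add: prod.union_disjoint ivl_disj_int)
  moreover have "(\<Prod>j<i. r j - x) = (\<Prod>j<i. - 1 * (x - r j))" by simp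
  then have "(\<Prod>j<i. r j - x) = (- 1) ^ i * (\<Prod>j<i. x - r j)"
    by (subst (asm) prod.distrib) simp
  ultimately have "(- 1) ^ i * poly (\<Prod>j<n. [:- r j, 1:]) x =
      (\<Prod>j<i. r j - x) * (\<Prod>j=i..<n. x - r j)"
    by (simp add: poly_prod mult.assoc)
  also have "\<dots> > 0"
    using assms by (intro mult_pos_pos prod_pos) auto
  finally show ?thesis .
qed

text \<open>
  For disjoint intervals \<open>[l i, u i]\<close> that move to the left as \<open>i\<close> grows, \<open>g 0\<close> lies to the right of all of
  them, \<open>g n\<close> to the left, and \<open>g i\<close> halfway between interval \<open>i - 1\<close> and interval \<open>i\<close>.
\<close>
lemma separating_points:
  fixes l u :: "nat \<Rightarrow> real"
  assumes "\<And>i. i < n \<Longrightarrow> l i \<le> u i" "\<And>i. Suc i < n \<Longrightarrow> u (Suc i) < l i"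
  shows "\<exists>g. \<forall>i\<le>n. (\<forall>j<i. g i < l j) \<and> (\<forall>j. i \<le> j \<and> j < n \<longrightarrow> u j < g i)"
proof -
  have step: "u j < l i" if "i < j" "j < n" for i j
    using that
  proof (induction rule: strict_inc_induct)
    case (base i)
    then show ?case using assms(2)[of i] by simp
  next
    case (step i)
    then show ?case using assms(1)[of "Suc i"] assms(2)[of i] by simp
  qed
  have low: "l i \<le> l j" if "j \<le> i" "i < n" for i j
    using step[of j i] assms(1)[of i] that by (cases "i = j") auto
  have up: "u j \<le> u i" if "i \<le> j" "j < n" for i j
    using step[of i j] assms(1)[of i] that by (cases "i = j") auto
  define g where "g i = (if i = 0 then u 0 + 1 else if i = n then l (n - 1) - 1
      else (l (i - 1) + u i) / 2)" for i
  have "g i < l j" if "i \<le> n" "j < i" for i j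
  proof -
    have "l (i - 1) \<le> l j" using that by (intro low) auto
    then show ?thesis
      using step[of "i - 1" i] that by (cases "i = n") (auto simp: g_def)
  qed
  moreover have "u j < g i" if "i \<le> j" "j < n" for i j
    using up[of i j] step[of "i - 1" i] that by (auto simp: g_def)
  ultimately show ?thesis by blast
qed

text \<open>
  Without common or multiple roots the intervals with endpoints \<open>\<lambda>\<^sub>i, \<mu>\<^sub>i\<close> are disjoint. At a point
  separating them \<open>p\<close> and \<open>q\<close> have the same sign, which is then the sign of the convex combination, and
  this sign alternates from one point to the next. The intermediate value theorem yields \<open>n\<close> roots.
\<close>
lemma simple_roots_convex_combination:
  assumes p: "simple_roots n p" and q: "simple_roots n q" 
    and inter: "common_interlacer p q"
    and disj: "\<And>x. poly p x = 0 \<Longrightarrow> poly q x \<noteq> 0"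
    and t: "t \<in> {0..1}"
  shows "simple_roots n (smult t p + smult (1 - t) q)"
proof -
  define a where "a i = desc_roots p ! i" for i
  define b where "b i = desc_roots q ! i" for i
  have P: "p = (\<Prod>i<n. [:- a i, 1:])" "\<And>i j. i < j \<Longrightarrow> j < n \<Longrightarrow> a j < a i" "degree p = n"
    using p unfolding simple_roots_def a_def by blast+
  have Q: "q = (\<Prod>i<n. [:- b i, 1:])" "\<And>i j. i < j \<Longrightarrow> j < n \<Longrightarrow> b j < b i" "degree q = n"
    using q unfolding simple_roots_def b_def by blast+
  have "\<forall>i. Suc i < n \<longrightarrow> max (a (Suc i)) (b (Suc i)) \<le> min (a i) (b i)"
    using common_interlacer_iff[of p q n] inter p q by (simp add: simple_roots_def a_def b_def)
  moreover have neq: "a i \<noteq> b j" if "i < n" "j < n" for i j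
  proof -
    have "poly p (a i) = 0" "poly q (b j) = 0"
      using that by (auto simp: P(1) Q(1) poly_prod)
    then show ?thesis using disj by metis
  qed
  ultimately have strict: "max (a (Suc i)) (b (Suc i)) < min (a i) (b i)" if "Suc i < n" for i
    using that P(2)[of i "Suc i"] Q(2)[of i "Suc i"] neq[of i "Suc i"] neq[of "Suc i" i]
    by (fastforce simp: less_le)
  have "\<exists>g. \<forall>i\<le>n. (\<forall>j<i. g i < min (a j) (b j)) \<and>
      (\<forall>j. i \<le> j \<and> j < n \<longrightarrow> max (a j) (b j) < g i)"
    by (rule separating_points) (use strict in auto)
  then obtain g where sep: "\<forall>i\<le>n. (\<forall>j<i. g i < min (a j) (b j)) \<and>
      (\<forall>j. i \<le> j \<and> j < n \<longrightarrow> max (a j) (b j) < g i)" by blast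
  then have g: "\<And>i j. i \<le> n \<Longrightarrow> j < i \<Longrightarrow> g i < min (a j) (b j)"
      "\<And>i j. i \<le> j \<Longrightarrow> j < n \<Longrightarrow> max (a j) (b j) < g i"
    by auto
  define f where "f = smult t p + smult (1 - t) q"
  have coeff: "coeff p n = 1" "coeff q n = 1"
    using P(1,3) Q(1,3) lead_coeff_prod[of "\<lambda>i. [:- a i, 1:]" "{..<n}"]
      lead_coeff_prod[of "\<lambda>i. [:- b i, 1:]" "{..<n}"] by simp_all
  then have cf: "coeff f n = 1" by (simp add: f_def)
  have "degree f \<le> n" unfolding f_def using P(3) Q(3)
    by (intro degree_add_le) (auto intro: order_trans[OF degree_smult_le])
  then have f: "degree f = n" "lead_coeff f = 1"
    using cf le_degree[of f n] by auto
  have sgn: "0 < (- 1) ^ i * poly f (g i)" if "i \<le> n" for i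
  proof -
    have "0 < (- 1) ^ i * poly p (g i)" "0 < (- 1) ^ i * poly q (g i)"
      unfolding P(1) Q(1) using g that by (intro sign_between_roots; force)+
    then have "0 < t * ((- 1) ^ i * poly p (g i)) + (1 - t) * ((- 1) ^ i * poly q (g i))"
      using t by (cases "t = 0") (auto intro: add_pos_nonneg)
    then show ?thesis by (simp add: f_def algebra_simps)
  qed
  have "\<exists>x. g (Suc i) < x \<and> x < g i \<and> poly f x = 0" if "i < n" for i
  proof -
    have "poly f (g (Suc i)) * poly f (g i) < 0"
      using sgn[of i] sgn[of "Suc i"] that
      by (cases "even i") (auto simp: mult_less_0_iff)
    moreover have "g (Suc i) < g i"
      using g(1)[of "Suc i" i] g(2)[of i i] that by auto
    ultimately show ?thesis using poly_IVT by blast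
  qed
  then obtain r where r: "\<And>i. i < n \<Longrightarrow> g (Suc i) < r i \<and> r i < g i \<and> poly f (r i) = 0"
    by metis
  have g_dec: "g j \<le> g i" if "i \<le> j" "j \<le> n" for i j
    using g(1)[of j i] g(2)[of i i] that by (cases "i = j") auto
  have "simple_roots n f"
  proof (rule simple_rootsI_decreasing[OF f])
    fix i j assume "i < j" "j < n"
    then show "r j < r i" using r[of i] r[of j] g_dec[of "Suc i" j] by auto
  qed (use r in auto)
  then show ?thesis by (simp add: f_def)
qed

lemma sum_roots_eq_coeff:
  fixes r :: "nat \<Rightarrow> real"
  shows "coeff (\<Prod>i<Suc n. [:- r i, 1:]) n = - (\<Sum>i<Suc n. r i)"
proof (induction n)
  case (Suc n)
  let ?P = "\<Prod>i<Suc n. [:- r i, 1:]"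
  have "degree ?P = Suc n" by (simp add: degree_prod_eq_sum_degree del: prod.lessThan_Suc)
  moreover have "lead_coeff ?P = 1" unfolding lead_coeff_prod by simp
  ultimately have "coeff ?P (Suc n) = 1" by simp
  moreover have "(\<Prod>i<Suc (Suc n). [:- r i, 1:]) = [:- r (Suc n), 1:] * ?P"
    by (simp only: prod.lessThan_Suc mult_ac)
  ultimately show ?case using Suc by (simp del: prod.lessThan_Suc)
qed simp

lemma simple_roots_sum:
  assumes "simple_roots n f" "0 < n"
  shows "(\<Sum>i<n. desc_roots f ! i) = - coeff f (n - 1)"
proof -
  obtain m where "n = Suc m" using assms(2) by (cases n) auto
  moreover have "f = (\<Prod>i<n. [:- (desc_roots f ! i), 1:])"
    using assms(1) by (simp add: simple_roots_def)
  ultimately show ?thesis using sum_roots_eq_coeff[of "\<lambda>i. desc_roots f ! i" m] by simp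
qed

section \<open>Strong majorization and strict monotonicity\<close>

theorem corollary4p1:
  fixes p q :: "real poly" and n :: nat
  assumes "degree p = n" and "degree q = n"
    and "lead_coeff p = 1" and "lead_coeff q = 1"
    and "real_rooted p" and "real_rooted q"
    and "rsquarefree p" and "rsquarefree q"
    and "common_interlacer p q"
    and "\<not> (\<exists>x. poly p x = 0 \<and> poly q x = 0)"
    and "(\<Sum>i<n. desc_roots p ! i) = (\<Sum>i<n. desc_roots q ! i)"
  shows "strongly_majorizes p q \<longleftrightarrow>
    (\<forall>k. 1 \<le> k \<and> k < n \<longrightarrow>
       strict_mono_on {0..1} (\<lambda>t. \<Sum>i<k. desc_roots (smult t p + smult (1 - t) q) ! i))"
proof -
  define f where "f t = smult t p + smult (1 - t) q" for t
  define S where "S k t = (\<Sum>i<k. desc_roots (f t) ! i)" for k t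
  have p: "simple_roots n p" and q: "simple_roots n q"
    using assms by (auto intro: simple_rootsI_rsquarefree)
  have disj: "poly q x \<noteq> 0" if "poly p x = 0" for x
    using assms(10) that by blast
  have f: "simple_roots n (f t)" if "t \<in> {0..1}" for t
    unfolding f_def
    using simple_roots_convex_combination[OF p q assms(9) _ that] disj by blast
  have S_n: "S n s = S n t" if "s \<in> {0..1}" "t \<in> {0..1}" for s t
  proof (cases "n = 0")
    case False
    then have "coeff p (n - 1) = coeff q (n - 1)"
      using simple_roots_sum[OF p] simple_roots_sum[OF q] assms(11) by simp
    then have "coeff (f t) (n - 1) = coeff q (n - 1)" for t
      by (simp add: f_def algebra_simps)
    then show ?thesis
      using simple_roots_sum[OF f] False that by (simp add: S_def)
  qed (simp add: S_def)
  have maj: "poly_majorizes (f s) (f t) \<longleftrightarrow> (\<forall>k. 1 \<le> k \<and> k < n \<longrightarrow> S k t \<le> S k s)"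
    if "s \<in> {0..1}" "t \<in> {0..1}" for s t
  proof -
    have "poly_majorizes (f s) (f t) \<longleftrightarrow> (\<forall>k\<le>n. S k t \<le> S k s)"
      using S_n[OF that] simple_rootsD(1-3)[OF f[OF that(1)]] simple_rootsD(1-3)[OF f[OF that(2)]]
      by (simp add: poly_majorizes_def majorizes_def S_def)
    also have "\<dots> \<longleftrightarrow> (\<forall>k. 1 \<le> k \<and> k < n \<longrightarrow> S k t \<le> S k s)"
    proof
      assume *: "\<forall>k. 1 \<le> k \<and> k < n \<longrightarrow> S k t \<le> S k s"
      show "\<forall>k\<le>n. S k t \<le> S k s"
      proof (intro allI impI)
        fix k assume "k \<le> n"
        then consider "k = 0" | "k = n" | "1 \<le> k" "k < n" by linarith
        then show "S k t \<le> S k s"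
          using * S_n[OF that] by cases (auto simp: S_def)
      qed
    qed auto
    finally show ?thesis .
  qed
  have strong: "strongly_majorizes p q \<longleftrightarrow>
      (\<forall>k. 1 \<le> k \<and> k < n \<longrightarrow> (\<forall>s t. 0 \<le> t \<and> t \<le> s \<and> s \<le> 1 \<longrightarrow> S k t \<le> S k s))"
    using maj assms(9) unfolding strongly_majorizes_def f_def[symmetric] by auto
  have strict: "S k t < S k s"
    if k: "1 \<le> k" "k < n" and mono: "\<And>s t. 0 \<le> t \<Longrightarrow> t \<le> s \<Longrightarrow> s \<le> 1 \<Longrightarrow> S k t \<le> S k s"
      and st: "0 \<le> t" "t < s" "s \<le> 1" for k s t
  proof (rule ccontr)
    assume "\<not> S k t < S k s"
    have "S k u = S k t" if "u \<in> {t..s}" for u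
      using mono[of t u] mono[of u s] \<open>\<not> S k t < S k s\<close> st that by simp
    moreover have "{t..s} \<subseteq> {0..1}" using st by auto
    ultimately have "{t..s} \<subseteq> {u \<in> {0..1}. S k u = S k t}" by blast
    moreover have "finite {u \<in> {0..1}. S k u = S k t}"
      unfolding S_def
    proof (rule finite_level_set_top_sum[where p = p and q = q and n = n])
      fix u :: real and i j assume u: "u \<in> {0..1}"
      show "smult u p + smult (1 - u) q = (\<Prod>i<n. [:- (desc_roots (f u) ! i), 1:])"
        using simple_rootsD(5)[OF f[OF u]] by (simp only: f_def)
      show "desc_roots (f u) ! j < desc_roots (f u) ! i" if "i < j" "j < n"
        using simple_rootsD(4)[OF f[OF u]] that by blast
    qed (use k disj in auto)
    ultimately show False
      using st infinite_Icc[of t s] finite_subset by blast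
  qed
  show ?thesis
    unfolding strong f_def[symmetric] S_def[symmetric]
  proof (intro iffI allI impI)
    fix k assume "\<forall>k. 1 \<le> k \<and> k < n \<longrightarrow> (\<forall>s t. 0 \<le> t \<and> t \<le> s \<and> s \<le> 1 \<longrightarrow> S k t \<le> S k s)"
      and "1 \<le> k \<and> k < n"
    then show "strict_mono_on {0..1} (S k)"
      by (intro strict_mono_onI strict) auto
  next
    fix k and s t :: real
    assume "\<forall>k. 1 \<le> k \<and> k < n \<longrightarrow> strict_mono_on {0..1} (S k)"
      and "1 \<le> k \<and> k < n" and "0 \<le> t \<and> t \<le> s \<and> s \<le> 1"
    then have "strict_mono_on {0..1} (S k)" "t \<in> {0..1}" "s \<in> {0..1}" "t \<le> s" by auto
    then show "S k t \<le> S k s"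
      using strict_mono_onD[of "{0..1}" "S k" t s] by (cases "t = s") auto
  qed
qed

end
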